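(* Suppose the entries of $\boldsymbol{\hat\phi}$ are i.i.d. with mean $\phi$ and variance $\frac{1}{N_e^2 r}$, and let $\epsilon(\mathbf{g},\mathbf{H}) = \mathbb{E}\big[(\mathbf{g}^T(\mathbf{H}\boldsymbol{\hat\phi}+\mathbf{n})-\phi)^2\big]$. Then for every $\mathbf{g}\in\mathbb{R}^K$ with $\mathbf{g}\neq\mathbf{0}$, $$\min_{\mathbf{H}\in\mathbb{R}^{K\times K}}\epsilon(\mathbf{g},\mathbf{H}) = v\,\mathbf{g}^T\mathbf{g}+\phi^2\left(\frac{\frac{1}{N_e^2 r}}{\frac{1}{N_e^2 r}+K\phi^2}\right).$$ Consequently, the globally optimal value $\inf_{\mathbf{g},\mathbf{H}}\epsilon(\mathbf{g},\mathbf{H})$ is approached as $\mathbf{g}\to\mathbf{0}$ with $\mathbf{g}\ne\mathbf{0}$, that is, $$\lim_{\mathbf{g}\to\mathbf{0},\,\mathbf{g}\neq\mathbf{0}}\ \min_{\mathbf{H}}\epsilon(\mathbf{g},\mathbf{H})=\inf_{\mathbf{g}\in\mathbb{R}^K,\,\mathbf{H}\in\mathbb{R}^{K\times K}}\epsilon(\mathbf{g},\mathbf{H}).$$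
   Context: Let $K,N_e,r\ge 1$ be integers, $\phi\in\mathbb{R}$ a fixed parameter and $v\ge 0$. The random vector $\boldsymbol{\hat\phi}=(\hat\phi_1,\dots,\hat\phi_K)^T$ collects the estimates of $\phi$ from $K$ clusters; each estimate is unbiased, $\mathbb{E}[\hat\phi_i]=\phi$, with variance $\frac{1}{N_e^2 r}$. The noise $\mathbf{n}=(n_1,\dots,n_K)^T$ has independent zero-mean Gaussian entries of variance $v$ and is independent of $\boldsymbol{\hat\phi}$ (noise is absent when $v=0$). The matrix $\mathbf{H}\in\mathbb{R}^{K\times K}$ (channel) and vector $\mathbf{g}\in\mathbb{R}^K$ (combiner) are deterministic, and the final estimate of $\phi$ is $\mathbf{g}^T(\mathbf{H}\boldsymbol{\hat\phi}+\mathbf{n})$. *)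

theory Defs
  imports "HOL-Probability.Probability"
begin

text \<open>
  A variance-\<open>v\<close> centred Gaussian has no Lebesgue density when \<open>v = 0\<close>; in that case it is
  the constant \<open>0\<close> (almost surely). The second parameter of \<^const>\<open>normal_density\<close> is the
  standard deviation.
\<close>
definition centered_gaussian :: "'a measure \<Rightarrow> real \<Rightarrow> ('a \<Rightarrow> real) \<Rightarrow> bool" where
  "centered_gaussian M v X \<longleftrightarrow>
     (if v = 0 then X \<in> borel_measurable M \<and> (AE \<omega> in M. X \<omega> = 0)
      else distributed M lborel X (\<lambda>x. ennreal (normal_density 0 (sqrt v) x)))"

definition mse ::
  "'a measure \<Rightarrow> real \<Rightarrow> ('a \<Rightarrow> real ^ 'k) \<Rightarrow> ('a \<Rightarrow> real ^ 'k) \<Rightarrow> real ^ 'k \<Rightarrow> real ^ 'k ^ 'k \<Rightarrow> real"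
where
  "mse M \<phi> \<phi>hat noise g H =
     prob_space.expectation M (\<lambda>\<omega>. (g \<bullet> (H *v \<phi>hat \<omega> + noise \<omega>) - \<phi>)\<^sup>2)"

text \<open>
  The least value of \<open>f\<close>. It is unspecified if \<open>f\<close> has no least value, so statements about it
  should also assert that the minimum is attained.
\<close>
definition min_value :: "('b \<Rightarrow> real) \<Rightarrow> real" where
  "min_value f = (LEAST y. y \<in> range f)"

end

theory Submission
  imports Defs
begin

text \<open>
  Only \<open>w = H\<^sup>T g\<close> matters: with \<open>s\<close> the variance of the estimates and \<open>S\<close> the sum of the
  entries of \<open>w\<close>, independence gives the error \<open>s |w|\<^sup>2 + \<phi>\<^sup>2 (S - 1)\<^sup>2 + v |g|\<^sup>2\<close>. Completing the
  square around the constant vector with entries \<open>c = \<phi>\<^sup>2 / (s + K \<phi>\<^sup>2)\<close> gives the minimum over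
  \<open>w\<close>, and for \<open>g \<noteq> 0\<close> every \<open>w\<close> is of the form \<open>H\<^sup>T g\<close>. The noise term vanishes as \<open>g\<close> tends
  to \<open>0\<close>, while the remaining term bounds the error from below for all \<open>g\<close> and \<open>H\<close>.
\<close>

text \<open>Expanding the square gives a double sum of mixed moments. Independence makes the
  covariances vanish, so each mixed moment is \<open>\<mu>\<^sup>2\<close>, with an extra
  \<open>\<sigma>2\<close> on the diagonal. The lemma serves both the estimates and, with mean 0,
  the noise.\<close>

lemma (in prob_space) second_moment_linear_form:
  fixes X :: "'a \<Rightarrow> real ^ 'k" and w :: "real ^ 'k"
  assumes indep: "indep_vars (\<lambda>_. borel) (\<lambda>i \<omega>. X \<omega> $ i) UNIV"
    and int: "\<And>i. integrable M (\<lambda>\<omega>. X \<omega> $ i)"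
    and int2: "\<And>i. integrable M (\<lambda>\<omega>. (X \<omega> $ i)\<^sup>2)"
    and mean: "\<And>i. expectation (\<lambda>\<omega>. X \<omega> $ i) = \<mu>"
    and var: "\<And>i. variance (\<lambda>\<omega>. X \<omega> $ i) = \<sigma>2"
  shows "integrable M (\<lambda>\<omega>. (w \<bullet> X \<omega>)\<^sup>2)"
    and "expectation (\<lambda>\<omega>. (w \<bullet> X \<omega>)\<^sup>2) = \<sigma>2 * (w \<bullet> w) + \<mu>\<^sup>2 * (\<Sum>i\<in>UNIV. w $ i)\<^sup>2"
proof -
  have prod: "integrable M (\<lambda>\<omega>. X \<omega> $ i * X \<omega> $ j) \<and>
      expectation (\<lambda>\<omega>. X \<omega> $ i * X \<omega> $ j) = (if i = j then \<sigma>2 else 0) + \<mu>\<^sup>2" for i j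
  proof (cases "i = j")
    case True
    have "\<sigma>2 = expectation (\<lambda>\<omega>. (X \<omega> $ i)\<^sup>2) - \<mu>\<^sup>2"
      using variance_eq[OF int int2, of i] by (simp add: mean var[unfolded mean])
    then show ?thesis
      using int2[of i] True by (simp add: power2_eq_square)
  next
    case False
    \<comment> \<open>On the two-element index set the product over the family is just
      \<open>X \<omega> $ i * X \<omega> $ j\<close>, so independence yields its integrability as
      well as its expectation.\<close>
    have "indep_vars (\<lambda>_. borel) (\<lambda>i \<omega>. X \<omega> $ i) {i, j}"
      by (rule indep_vars_subset[OF indep]) simp
    from indep_vars_lebesgue_integral[OF _ this] indep_vars_integrable[OF _ this] int mean False
    show ?thesis by (simp add: power2_eq_square)
  qed
  have expand: "(w \<bullet> X \<omega>)\<^sup>2 = (\<Sum>i\<in>UNIV. \<Sum>j\<in>UNIV. (w $ i * w $ j) * (X \<omega> $ i * X \<omega> $ j))" for \<omega>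
    by (simp add: inner_vec_def power2_eq_square sum_product mult_ac)
  show "integrable M (\<lambda>\<omega>. (w \<bullet> X \<omega>)\<^sup>2)"
    unfolding expand using prod by (intro Bochner_Integration.integrable_sum integrable_mult_right) auto
  have "expectation (\<lambda>\<omega>. (w \<bullet> X \<omega>)\<^sup>2) =
      (\<Sum>i\<in>UNIV. \<Sum>j\<in>UNIV. (w $ i * w $ j) * ((if i = j then \<sigma>2 else 0) + \<mu>\<^sup>2))"
    unfolding expand using prod by simp
  also have "\<dots> = (\<Sum>i\<in>UNIV. \<Sum>j\<in>UNIV. if i = j then \<sigma>2 * (w $ i * w $ j) else 0)
      + \<mu>\<^sup>2 * (\<Sum>i\<in>UNIV. \<Sum>j\<in>UNIV. w $ i * w $ j)"
    unfolding sum_distrib_left sum.distrib[symmetric]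
    by (intro sum.cong refl) (simp add: algebra_simps)
  also have "\<dots> = \<sigma>2 * (w \<bullet> w) + \<mu>\<^sup>2 * (\<Sum>i\<in>UNIV. w $ i)\<^sup>2"
    unfolding power2_eq_square[of "sum _ _"] sum_product by (simp add: inner_vec_def sum_distrib_left)
  finally show "expectation (\<lambda>\<omega>. (w \<bullet> X \<omega>)\<^sup>2) = \<sigma>2 * (w \<bullet> w) + \<mu>\<^sup>2 * (\<Sum>i\<in>UNIV. w $ i)\<^sup>2" .
qed

lemma (in prob_space) centered_gaussian_moments:
  assumes "v \<ge> 0" and gauss: "centered_gaussian M v X"
  shows "integrable M X" and "integrable M (\<lambda>\<omega>. (X \<omega>)\<^sup>2)"
    and "expectation X = 0" and "variance X = v"
proof -
  have "integrable M X \<and> integrable M (\<lambda>\<omega>. (X \<omega>)\<^sup>2) \<and> expectation X = 0 \<and> variance X = v"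
  proof (cases "v = 0")
    case True
    with gauss have [measurable]: "X \<in> borel_measurable M" and ae: "AE \<omega> in M. X \<omega> = 0"
      by (simp_all add: centered_gaussian_def)
    have ae2: "AE \<omega> in M. (X \<omega>)\<^sup>2 = 0"
      using ae by simp
    have "integrable M X" "expectation X = 0"
      using integrable_cong_AE[of X M "\<lambda>_. 0"] integral_cong_AE[of X M "\<lambda>_. 0"] ae by simp_all
    moreover have "integrable M (\<lambda>\<omega>. (X \<omega>)\<^sup>2)" "expectation (\<lambda>\<omega>. (X \<omega>)\<^sup>2) = 0"
      using integrable_cong_AE[of "\<lambda>\<omega>. (X \<omega>)\<^sup>2" M "\<lambda>_. 0"]
        integral_cong_AE[of "\<lambda>\<omega>. (X \<omega>)\<^sup>2" M "\<lambda>_. 0"] ae2 by simp_all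
    ultimately show ?thesis using True by simp
  next
    case False
    with \<open>v \<ge> 0\<close> have pos: "0 < sqrt v" by simp
    have D: "distributed M lborel X (normal_density 0 (sqrt v))"
      using gauss False by (simp add: centered_gaussian_def)
    have "integrable M X"
      by (rule distributed_integrable_var[OF D _ integrable_normal_moment_nz_1[OF pos]]) simp
    moreover have "integrable M (\<lambda>\<omega>. (X \<omega>)\<^sup>2)"
      using distributed_integrable[OF D, of "\<lambda>x. x\<^sup>2"] integrable_normal_moment[OF pos, of 0 2] by simp
    ultimately show ?thesis
      using normal_distributed_expectation[OF pos D] normal_distributed_variance[OF pos D] \<open>v \<ge> 0\<close>
      by simp
  qed
  then show "integrable M X" "integrable M (\<lambda>\<omega>. (X \<omega>)\<^sup>2)" "expectation X = 0" "variance X = v"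
    by auto
qed

text \<open>The estimate splits into a signal part \<open>A\<close> and a noise part
  \<open>B\<close>. They are independent and \<open>B\<close> has mean 0, so the cross terms drop
  out; what is left is the noise power, the variance of \<open>A\<close> and the squared bias of
  \<open>A\<close>.\<close>

lemma (in prob_space) mse_eq:
  fixes \<phi>hat noise :: "'a \<Rightarrow> real ^ 'k" and g :: "real ^ 'k"
  assumes "v \<ge> 0"
    and indep: "indep_vars (\<lambda>_. borel) (\<lambda>i \<omega>. \<phi>hat \<omega> $ i) UNIV"
    and int: "\<And>i. integrable M (\<lambda>\<omega>. \<phi>hat \<omega> $ i)"
    and int2: "\<And>i. integrable M (\<lambda>\<omega>. (\<phi>hat \<omega> $ i)\<^sup>2)"
    and mean: "\<And>i. expectation (\<lambda>\<omega>. \<phi>hat \<omega> $ i) = \<phi>"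
    and var: "\<And>i. variance (\<lambda>\<omega>. \<phi>hat \<omega> $ i) = s"
    and indep_noise: "indep_vars (\<lambda>_. borel) (\<lambda>i \<omega>. noise \<omega> $ i) UNIV"
    and gauss: "\<And>i. centered_gaussian M v (\<lambda>\<omega>. noise \<omega> $ i)"
    and indep2: "indep_var borel \<phi>hat borel noise"
  shows "mse M \<phi> \<phi>hat noise g H = v * (g \<bullet> g) +
    (s * ((g v* H) \<bullet> (g v* H)) + \<phi>\<^sup>2 * ((\<Sum>i\<in>UNIV. (g v* H) $ i) - 1)\<^sup>2)"
proof -
  define w where "w = g v* H"
  define A where "A \<omega> = w \<bullet> \<phi>hat \<omega>" for \<omega>
  define B where "B \<omega> = g \<bullet> noise \<omega>" for \<omega>
  note noise = centered_gaussian_moments[OF \<open>v \<ge> 0\<close> gauss]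
  note A2 = second_moment_linear_form[OF indep int int2 mean var, of w, folded A_def]
  note B2 = second_moment_linear_form[OF indep_noise noise, of g, folded B_def]
  have A1: "integrable M A" "expectation A = \<phi> * (\<Sum>i\<in>UNIV. w $ i)"
    unfolding A_def[abs_def] inner_vec_def using int mean by (simp_all add: sum_distrib_left mult.commute)
  have B1: "integrable M B" "expectation B = 0"
    unfolding B_def[abs_def] inner_vec_def using noise by simp_all
  \<comment> \<open>Both parts are measurable functionals of the independent vectors
    \<open>\<phi>hat\<close> and \<open>noise\<close>.\<close>
  have "indep_var borel A borel B"
    using indep_var_compose[OF indep2, of "\<lambda>x. w \<bullet> x" borel "\<lambda>x. g \<bullet> x" borel]
    by (simp add: A_def[abs_def] B_def[abs_def] comp_def)
  note AB = indep_var_integrable[OF this A1(1) B1(1)] indep_var_lebesgue_integral[OF this A1(1) B1(1)]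
  have "mse M \<phi> \<phi>hat noise g H = expectation (\<lambda>\<omega>. (A \<omega> + B \<omega> - \<phi>)\<^sup>2)"
    by (simp add: mse_def A_def B_def w_def inner_add_right dot_lmul_matrix)
  also have "\<dots> = expectation (\<lambda>\<omega>. (A \<omega>)\<^sup>2 + (B \<omega>)\<^sup>2 + \<phi>\<^sup>2 + 2 * (A \<omega> * B \<omega>)
      - 2 * \<phi> * A \<omega> - 2 * \<phi> * B \<omega>)"
    by (simp add: power2_eq_square algebra_simps)
  also have "\<dots> = expectation (\<lambda>\<omega>. (A \<omega>)\<^sup>2) + expectation (\<lambda>\<omega>. (B \<omega>)\<^sup>2) + \<phi>\<^sup>2
      + 2 * (expectation A * expectation B) - 2 * \<phi> * expectation A - 2 * \<phi> * expectation B"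
    using A2(1) B2(1) A1(1) B1(1) AB by (simp add: prob_space)
  also have "\<dots> = v * (g \<bullet> g) + (s * (w \<bullet> w) + \<phi>\<^sup>2 * ((\<Sum>i\<in>UNIV. w $ i) - 1)\<^sup>2)"
    unfolding A1 B1 A2 B2 by (simp add: power2_eq_square algebra_simps)
  finally show ?thesis unfolding w_def .
qed

text \<open>The constant \<open>c\<close> comes from stationarity: the gradient in \<open>w\<close>
  vanishes when \<open>s * w $ i = \<phi>\<^sup>2 * (1 - S)\<close> for all \<open>i\<close>, where
  \<open>S\<close> is the sum of the entries. Hence all entries equal some \<open>c\<close> with
  \<open>s * c = \<phi>\<^sup>2 * (1 - K * c)\<close>.\<close>

lemma quadratic_complete_square:
  fixes w :: "real ^ 'k" and s \<phi> :: real
  assumes "s > 0"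
  defines "D \<equiv> s + real CARD('k) * \<phi>\<^sup>2"
  defines "c \<equiv> \<phi>\<^sup>2 / D"
  shows "s * (w \<bullet> w) + \<phi>\<^sup>2 * ((\<Sum>i\<in>UNIV. w $ i) - 1)\<^sup>2 =
    \<phi>\<^sup>2 * (s / D) + s * ((w - vec c) \<bullet> (w - vec c))
      + \<phi>\<^sup>2 * ((\<Sum>i\<in>UNIV. w $ i) - real CARD('k) * c)\<^sup>2"
proof -
  define K where "K = real CARD('k)"
  define S where "S = (\<Sum>i\<in>UNIV. w $ i)"
  have "D > 0"
    unfolding D_def using \<open>s > 0\<close> by (intro add_pos_nonneg) auto
  \<comment> \<open>The stationarity condition and the minimal value in terms of \<open>c\<close>;
    the remaining algebra uses only these two facts about \<open>c\<close> and
    \<open>D\<close>.\<close>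
  then have c: "s * c = \<phi>\<^sup>2 * (1 - K * c)" and sD: "s / D = 1 - K * c"
    by (simp_all add: c_def D_def K_def field_simps)
  have "(w - vec c) \<bullet> (w - vec c) = w \<bullet> w - 2 * c * S + K * c\<^sup>2"
    by (simp add: inner_vec_def S_def K_def algebra_simps sum.distrib sum_subtractf
        sum_distrib_left power2_eq_square)
  then have "s * ((w - vec c) \<bullet> (w - vec c)) = s * (w \<bullet> w - 2 * c * S + K * c\<^sup>2)"
    by (rule arg_cong)
  \<comment> \<open>Grouping by \<open>s * c\<close> lets stationarity turn every term except
    \<open>s * (w \<bullet> w)\<close> into a multiple of \<open>\<phi>\<^sup>2\<close>.\<close>
  also have "\<dots> = s * (w \<bullet> w) - 2 * (s * c) * S + K * c * (s * c)"
    by (simp add: algebra_simps power2_eq_square)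
  finally have *: "s * ((w - vec c) \<bullet> (w - vec c)) = s * (w \<bullet> w) - 2 * (s * c) * S + K * c * (s * c)" .
  show ?thesis
    unfolding sD * c by (fold S_def K_def) (simp add: power2_eq_square algebra_simps)
qed

text \<open>The witness is the rank-one matrix with rows
  \<open>(g $ i / (g \<bullet> g)) * w\<close>; multiplying by \<open>g\<close> from the left
  produces the factor \<open>g \<bullet> g\<close>, which cancels because
  \<open>g \<noteq> 0\<close>.\<close>

lemma vector_matrix_mult_surj:
  fixes g w :: "real ^ 'k"
  assumes "g \<noteq> 0"
  obtains H :: "real ^ 'k ^ 'k" where "g v* H = w"
proof
  have "(\<Sum>i\<in>UNIV. g $ i * (w $ j * g $ i / (g \<bullet> g))) = w $ j" for j
  proof -
    have "(\<Sum>i\<in>UNIV. g $ i * (w $ j * g $ i / (g \<bullet> g))) = w $ j * (g \<bullet> g) / (g \<bullet> g)"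
      unfolding inner_vec_def[of g g] by (simp add: sum_distrib_left sum_divide_distrib mult_ac)
    then show ?thesis using assms by simp
  qed
  then show "g v* (\<chi> i j. w $ j * g $ i / (g \<bullet> g)) = w"
    by (simp add: vector_matrix_mult_def vec_eq_iff mult_ac)
qed

lemma min_value_eqI:
  assumes "f x = m" and "\<And>y. m \<le> f y"
  shows "min_value f = m"
  unfolding min_value_def using assms by (intro Least_equality) auto

theorem lemma2:
  fixes M :: "'a measure"
    and \<phi> v :: real
    and Ne r :: nat
    and \<phi>hat noise :: "'a \<Rightarrow> real ^ 'k"
  assumes "prob_space M"
    and "Ne \<ge> 1" and "r \<ge> 1" and "v \<ge> 0"
    and "prob_space.indep_vars M (\<lambda>_. borel) (\<lambda>i \<omega>. \<phi>hat \<omega> $ i) UNIV"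
    and "\<And>i j. distr M borel (\<lambda>\<omega>. \<phi>hat \<omega> $ i) = distr M borel (\<lambda>\<omega>. \<phi>hat \<omega> $ j)"
    and "\<And>i. integrable M (\<lambda>\<omega>. \<phi>hat \<omega> $ i)"
    and "\<And>i. integrable M (\<lambda>\<omega>. (\<phi>hat \<omega> $ i)\<^sup>2)"
    and "\<And>i. prob_space.expectation M (\<lambda>\<omega>. \<phi>hat \<omega> $ i) = \<phi>"
    and "\<And>i. prob_space.variance M (\<lambda>\<omega>. \<phi>hat \<omega> $ i) = 1 / ((real Ne)\<^sup>2 * real r)"
    and "prob_space.indep_vars M (\<lambda>_. borel) (\<lambda>i \<omega>. noise \<omega> $ i) UNIV"
    and "\<And>i. centered_gaussian M v (\<lambda>\<omega>. noise \<omega> $ i)"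
    and "prob_space.indep_var M borel \<phi>hat borel noise"
  shows "(\<forall>g :: real ^ 'k. g \<noteq> 0 \<longrightarrow>
            (\<exists>H. is_arg_min (mse M \<phi> \<phi>hat noise g) (\<lambda>_. True) H) \<and>
            min_value (mse M \<phi> \<phi>hat noise g) =
              v * (g \<bullet> g) +
              \<phi>\<^sup>2 * ((1 / ((real Ne)\<^sup>2 * real r)) /
                     (1 / ((real Ne)\<^sup>2 * real r) + real CARD('k) * \<phi>\<^sup>2))) \<and>
         ((\<lambda>g. min_value (mse M \<phi> \<phi>hat noise g)) \<longlongrightarrow>
            (INF (g, H) \<in> UNIV. mse M \<phi> \<phi>hat noise g H)) (at 0)"
proof -
  interpret prob_space M by fact
  define s where "s = 1 / ((real Ne)\<^sup>2 * real r)"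
  have "s > 0" using assms(2,3) by (simp add: s_def)
  define K where "K = real CARD('k)"
  define m where "m = \<phi>\<^sup>2 * (s / (s + K * \<phi>\<^sup>2))"
  define c where "c = \<phi>\<^sup>2 / (s + K * \<phi>\<^sup>2)"
  let ?e = "mse M \<phi> \<phi>hat noise"
  have mse: "?e g H = v * (g \<bullet> g) + (m + s * ((g v* H - vec c) \<bullet> (g v* H - vec c))
      + \<phi>\<^sup>2 * ((\<Sum>i\<in>UNIV. (g v* H) $ i) - K * c)\<^sup>2)" for g H
    using mse_eq[OF assms(4,5,7-9) assms(10)[folded s_def] assms(11-13), of g H]
      quadratic_complete_square[OF \<open>s > 0\<close>, of "g v* H" \<phi>]
    by (simp add: m_def c_def K_def)
  have lower: "v * (g \<bullet> g) + m \<le> ?e g H" for g H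
    unfolding mse using \<open>s > 0\<close> by simp
  have attained: "\<exists>H. ?e g H = v * (g \<bullet> g) + m" if g: "g \<noteq> 0" for g
  proof -
    obtain H :: "real ^ 'k ^ 'k" where H: "g v* H = vec c" by (rule vector_matrix_mult_surj[OF g])
    have "?e g H = v * (g \<bullet> g) + m" unfolding mse H by (simp add: K_def)
    then show ?thesis ..
  qed
  have min: "min_value (?e g) = v * (g \<bullet> g) + m" if "g \<noteq> 0" for g
    using attained[OF that] lower min_value_eqI by metis
  have arg_min: "\<exists>H. is_arg_min (?e g) (\<lambda>_. True) H" if "g \<noteq> 0" for g
    using attained[OF that] lower unfolding is_arg_min_def by (metis not_le)
  have tendsto: "((\<lambda>g :: real ^ 'k. v * (g \<bullet> g) + m) \<longlongrightarrow> m) (at 0)"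
    by (rule tendsto_eq_intros refl | simp)+
  have m_le: "m \<le> ?e g H" for g H
    using lower[of g H] \<open>v \<ge> 0\<close> by (meson add_increasing inner_ge_zero mult_nonneg_nonneg order.trans order_refl)
  have inf: "(INF (g, H) \<in> UNIV. ?e g H) = m"
  proof (rule antisym)
    \<comment> \<open>A real infimum lies below the values only if these are bounded below;
      \<open>m\<close> provides the bound.\<close>
    have "(INF (g, H) \<in> UNIV. ?e g H) \<le> v * (g \<bullet> g) + m" if g: "g \<noteq> 0" for g :: "real ^ 'k"
    proof -
      obtain H where H: "?e g H = v * (g \<bullet> g) + m" using attained[OF g] ..
      have "(INF (g, H) \<in> UNIV. ?e g H) \<le> (case (g, H) of (g, H) \<Rightarrow> ?e g H)"
        by (rule cINF_lower) (auto intro!: bdd_belowI2[of _ m] m_le)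
      with H show ?thesis by simp
    qed
    \<comment> \<open>The infimum does not depend on \<open>g\<close>, so letting \<open>g\<close>
      tend to 0 through nonzero vectors removes the noise term from the bound.\<close>
    then show "(INF (g, H) \<in> UNIV. ?e g H) \<le> m"
      by (intro tendsto_lowerbound[OF tendsto]) (auto simp: eventually_at_filter)
    show "m \<le> (INF (g, H) \<in> UNIV. ?e g H)"
      by (rule cINF_greatest) (auto intro: m_le)
  qed
  \<comment> \<open>The filter \<open>at 0\<close> excludes the point 0 itself, so the formula for
    nonzero \<open>g\<close> suffices.\<close>
  have "((\<lambda>g. min_value (?e g)) \<longlongrightarrow> m) (at 0)"
    by (rule Lim_transform_eventually[OF tendsto]) (simp add: eventually_at_filter min)
  then show ?thesis
    unfolding inf using min arg_min by (simp add: m_def s_def K_def)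
qed

end
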